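(* Let $F,\|\cdot\|,\psi,q,\tau,L,\kappa,\mu$ satisfy the Assumption in the context, with $\kappa<q$, and let $D_\psi(x_\star,x_1)\le B$. Suppose Algorithm 1 (see context) is run with parameters such that for all $t\ge1$ $$\max\left(\Big(\frac{qL\eta_t}{\kappa}\Big)^{\frac1{q-1}},\Big(\frac{L\alpha_t}{\kappa}\Big)^{\frac1{q-1}}\right)\le K^{n_1}t^{n_2},$$ where $n_1,n_2\ge0$ and $K>0$ do not depend on $t$ and $K^{n_1}>B$ ($K^{n_1}$ may depend on $(L,\tau,\mu)$). Define $R_t=\max\{\|x_t-x_\star\|,\|x_t^{ag}-x_\star\|,\|x_t^{md}-x_\star\|\}$. Then for all $t\ge1$ $$R_t=\mathcal{O}\Big(K^{\frac{n_1(q-1)}{q-\kappa}}\,t^{\frac{(q-1)(n_2+1)}{q-\kappa}}\Big),$$ where $\mathcal{O}$ hides a constant that does not depend on $t$.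
   Context: For a continuously differentiable $G:\mathbb{R}^d\to\mathbb{R}$ the Bregman divergence is $D_G(x,y):=G(x)-G(y)-\langle\nabla G(y),x-y\rangle$ (convexity of $G$ is not assumed). Assumption. $\|\cdot\|$ is an arbitrary norm on $\mathbb{R}^d$; $F,\psi:\mathbb{R}^d\to\mathbb{R}$ are continuously differentiable; $q\ge2$, $1<\kappa\le2$, $\tau,L,\mu>0$; and - $F$ is $\tau$-star-convex: there exists $x_\star\in\arg\min F$ such that $\tau\langle\nabla F(x),x-x_\star\rangle\ge F(x)-F(x_\star)$ for all $x\in\mathbb{R}^d$; fix this $x_\star$. - $F$ is $(L,\kappa)$-weakly smooth with respect to $\|\cdot\|$: $|D_F(x,y)|\le\frac{L}{\kappa}\|x-y\|^\kappa$ for all $x,y$. - $\psi$ is $(\mu,q)$-uniformly convex with respect to $\|\cdot\|$: $D_\psi(x,y)\ge\frac{\mu}{q}\|x-y\|^q$ for all $x,y$. Algorithm 1 (accelerated mirror descent with binary search). Input: a starting point $x_1=x_1^{ag}\in\mathbb{R}^d$, number of iterations $T$, parameters $(C_t,\epsilon_t,\alpha_t,\eta_t)_{t\ge1}$ with step sizes $\alpha_t,\eta_t>0$. For $t=1,\dots,T$: 1. by binary search between the endpoints $x_t,x_t^{ag}$, find $\lambda_t\in[0,1]$ such that, with $x_t^{md}=\lambda_tx_t^{ag}+(1-\lambda_t)x_t$, one has $\langle\nabla F(x_t^{md}),x_t^{md}-x_t\rangle+C_t\big(F(x_t^{md})-F(x_t^{ag})\big)\le\epsilon_t$; 2. $x_{t+1}=\arg\min_{x\in\mathbb{R}^d}\{\eta_t\langle\nabla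 F(x_t^{md}),x\rangle+D_\psi(x,x_t)\}$; 3. $x_{t+1}^{ag}\in\arg\min_{x\in\mathbb{R}^d}\{\alpha_t\langle\nabla F(x_t^{md}),x\rangle+\frac{\mu}{q}\|x-x_t^{md}\|^q\}$ (any minimizer). Output $x_{T+1}^{ag}$. *)

theory Defs
  imports "HOL-Analysis.Analysis"
begin

(* An arbitrary norm on R^d; the type-class norm on real ^ 'd is the Euclidean one.
   Non-negativity follows from homogeneity and the triangle inequality. *)
definition is_norm :: "(real ^ 'd \<Rightarrow> real) \<Rightarrow> bool" where
  "is_norm N \<longleftrightarrow>
     (\<forall>x. N x = 0 \<longleftrightarrow> x = 0) \<and>
     (\<forall>c x. N (c *\<^sub>R x) = \<bar>c\<bar> * N x) \<and>
     (\<forall>x y. N (x + y) \<le> N x + N y)"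

definition grad :: "(real ^ 'd \<Rightarrow> real) \<Rightarrow> real ^ 'd \<Rightarrow> real ^ 'd" where
  "grad G x = (THE g. GDERIV G x :> g)"

definition cont_diff :: "(real ^ 'd \<Rightarrow> real) \<Rightarrow> bool" where
  "cont_diff G \<longleftrightarrow> (\<forall>x. GDERIV G x :> grad G x) \<and> continuous_on UNIV (grad G)"

definition bregman :: "(real ^ 'd \<Rightarrow> real) \<Rightarrow> real ^ 'd \<Rightarrow> real ^ 'd \<Rightarrow> real" where
  "bregman G x y = G x - G y - grad G y \<bullet> (x - y)"

definition argmin_set :: "('a \<Rightarrow> real) \<Rightarrow> 'a set" where
  "argmin_set f = {x. is_arg_min f (\<lambda>_. True) x}"

definition star_convex_at ::
  "real \<Rightarrow> (real ^ 'd \<Rightarrow> real) \<Rightarrow> real ^ 'd \<Rightarrow> bool" where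
  "star_convex_at \<tau> F x\<^sub>0 \<longleftrightarrow>
     x\<^sub>0 \<in> argmin_set F \<and> (\<forall>x. \<tau> * (grad F x \<bullet> (x - x\<^sub>0)) \<ge> F x - F x\<^sub>0)"

definition weakly_smooth ::
  "(real ^ 'd \<Rightarrow> real) \<Rightarrow> real \<Rightarrow> real \<Rightarrow> (real ^ 'd \<Rightarrow> real) \<Rightarrow> bool" where
  "weakly_smooth N L \<kappa> F \<longleftrightarrow>
     (\<forall>x y. \<bar>bregman F x y\<bar> \<le> L / \<kappa> * N (x - y) powr \<kappa>)"

definition uniformly_convex ::
  "(real ^ 'd \<Rightarrow> real) \<Rightarrow> real \<Rightarrow> real \<Rightarrow> (real ^ 'd \<Rightarrow> real) \<Rightarrow> bool" where
  "uniformly_convex N \<mu> q \<psi> \<longleftrightarrow>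
     (\<forall>x y. bregman \<psi> x y \<ge> \<mu> / q * N (x - y) powr q)"

(* The sequences xs, xag, xmd form a run of T iterations of accelerated mirror descent with
   binary search. The binary search enters only through the condition its result lam t
   satisfies. The iterates xs, xag are meaningful at indices 1..T+1, and lam, xmd at 1..T;
   values at other indices (in particular 0) are unconstrained. *)
definition amd_run ::
  "(real ^ 'd \<Rightarrow> real) \<Rightarrow> (real ^ 'd \<Rightarrow> real) \<Rightarrow> (real ^ 'd \<Rightarrow> real) \<Rightarrow> real \<Rightarrow> real \<Rightarrow>
   (nat \<Rightarrow> real) \<Rightarrow> (nat \<Rightarrow> real) \<Rightarrow> (nat \<Rightarrow> real) \<Rightarrow> (nat \<Rightarrow> real) \<Rightarrow> nat \<Rightarrow>
   (nat \<Rightarrow> real) \<Rightarrow> (nat \<Rightarrow> real ^ 'd) \<Rightarrow> (nat \<Rightarrow> real ^ 'd) \<Rightarrow> (nat \<Rightarrow> real ^ 'd) \<Rightarrow> bool" where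
  "amd_run N F \<psi> \<mu> q C \<epsilon> \<alpha> \<eta> T lam xs xag xmd \<longleftrightarrow>
     xag 1 = xs 1 \<and>
     (\<forall>t\<in>{1..T}.
        lam t \<in> {0..1} \<and>
        xmd t = lam t *\<^sub>R xag t + (1 - lam t) *\<^sub>R xs t \<and>
        grad F (xmd t) \<bullet> (xmd t - xs t) + C t * (F (xmd t) - F (xag t)) \<le> \<epsilon> t \<and>
        xs (Suc t) \<in> argmin_set (\<lambda>x. \<eta> t * (grad F (xmd t) \<bullet> x) + bregman \<psi> x (xs t)) \<and>
        xag (Suc t) \<in>
          argmin_set (\<lambda>x. \<alpha> t * (grad F (xmd t) \<bullet> x) + \<mu> / q * N (x - xmd t) powr q))"

end

theory Submission
  imports Defs
begin

text \<open>
  The iterates grow only polynomially because the length of a step is sublinear in the current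
  distance to the minimiser. Write \<open>r\<close> for the distance of a query point to \<open>x\<^sub>\<star>\<close>. As \<open>\<nabla>F(x\<^sub>\<star>) = 0\<close>, weak smoothness
  makes the dual norm of the gradient there \<open>O(L r powr (\<kappa> - 1))\<close>. Each of the two updates
  minimises a linear function with this gradient plus a regulariser that grows at least like the
  \<open>q\<close>-th power of the distance from its centre, so by comparison with the centre it moves by
  \<open>O((L r powr (\<kappa> - 1) * step size) powr (1 / (q - 1)))\<close>. With \<open>p = (\<kappa> - 1) / (q - 1)\<close> and
  \<open>M = K powr n1\<close>, the larger distance \<open>S t\<close> of the two iterates to \<open>x\<^sub>\<star>\<close> therefore satisfies
  \<open>S (t + 1) \<le> S t + A M t powr n2 * S t powr p\<close>
  (\<open>proximal_step_bound\<close>, \<open>gradient_growth_from_weak_smoothness\<close>).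

  The condition \<open>\<kappa> < q\<close> says \<open>p < 1\<close>, and the recursion with a sublinear increment has
  polynomial growth: comparing with the differential equation \<open>S' = A M t powr n2 * S powr p\<close>
  suggests \<open>S \<approx> M powr (1 / (1 - p)) * t powr ((n2 + 1) / (1 - p))\<close>, and a multiple of this
  function is indeed a supersolution (\<open>sublinear_recursion_bound\<close>). It also dominates the
  initial distance, as \<open>M > B\<close> bounds \<open>D\<^sub>\<psi>(x\<^sub>\<star>, x\<^sub>1)\<close>. The query point is a convex combination of
  the two iterates, so it obeys the same bound.
\<close>

lemma is_norm_zero: "is_norm N \<Longrightarrow> N 0 = 0"
  by (auto simp: is_norm_def)

lemma is_norm_scale: "is_norm N \<Longrightarrow> N (c *\<^sub>R x) = \<bar>c\<bar> * N x"
  by (auto simp: is_norm_def)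

lemma is_norm_triangle: "is_norm N \<Longrightarrow> N (x + y) \<le> N x + N y"
  by (auto simp: is_norm_def)

lemma is_norm_minus: "is_norm N \<Longrightarrow> N (- x) = N x"
  using is_norm_scale[of N "-1" x] by simp

lemma is_norm_nonneg: "is_norm N \<Longrightarrow> 0 \<le> N x"
  using is_norm_triangle[of N x "- x"] is_norm_minus[of N x] is_norm_zero[of N] by simp

lemma is_norm_pos: "is_norm N \<Longrightarrow> x \<noteq> 0 \<Longrightarrow> 0 < N x"
  using is_norm_nonneg[of N x] by (auto simp: is_norm_def less_le)

lemma is_norm_convex_comb_le:
  assumes "is_norm N" "l \<in> {0..1}" "N (x - z) \<le> R" "N (y - z) \<le> R"
  shows "N (l *\<^sub>R x + (1 - l) *\<^sub>R y - z) \<le> R"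
proof -
  have "l *\<^sub>R x + (1 - l) *\<^sub>R y - z = l *\<^sub>R (x - z) + (1 - l) *\<^sub>R (y - z)"
    by (simp add: algebra_simps)
  then have "N (l *\<^sub>R x + (1 - l) *\<^sub>R y - z) \<le> l * N (x - z) + (1 - l) * N (y - z)"
    using is_norm_triangle[OF assms(1), of "l *\<^sub>R (x - z)" "(1 - l) *\<^sub>R (y - z)"] assms(2)
    by (simp add: is_norm_scale[OF assms(1)])
  also have "\<dots> \<le> R"
    using assms by (intro convex_bound_le) auto
  finally show ?thesis .
qed

lemma argmin_set_le: "x \<in> argmin_set f \<Longrightarrow> f x \<le> f y"
  by (auto simp: argmin_set_def is_arg_min_def not_less)

lemma grad_at_argmin:
  assumes "cont_diff F" "x \<in> argmin_set F"
  shows "grad F x = 0"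
proof -
  have "(F has_derivative (\<lambda>h. h \<bullet> grad F x)) (at x)"
    using assms(1) by (auto simp: cont_diff_def gderiv_def)
  then have "(\<lambda>h. h \<bullet> grad F x) = (\<lambda>h. 0)"
    by (rule has_derivative_local_min) (simp add: argmin_set_le[OF assms(2)])
  then have "grad F x \<bullet> grad F x = 0"
    by meson
  then show ?thesis
    by simp
qed

text \<open>
  Since the gradient vanishes at \<open>z\<close>, Bregman divergences from \<open>z\<close> are differences of function
  values. Hence \<open>\<nabla>F(y) \<bullet> k\<close> is a combination of the three divergences between \<open>y + k\<close>, \<open>y\<close> and
  \<open>z\<close>, whatever \<open>k\<close> is. All three are at most of order \<open>N (y - z) powr \<kappa>\<close> when \<open>k\<close> has length
  \<open>N (y - z)\<close>, and homogeneity turns this into a bound for every direction. The constant 6 is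
  \<open>2\<^sup>2 + 1 + 1\<close>.
\<close>

lemma gradient_growth_from_weak_smoothness:
  assumes N: "is_norm N" and smooth: "weakly_smooth N L \<kappa> F" and crit: "grad F z = 0"
    and "0 < \<kappa>" "\<kappa> \<le> 2" "0 < L"
  shows "\<bar>grad F y \<bullet> h\<bar> \<le> 6 * (L / \<kappa>) * N (y - z) powr (\<kappa> - 1) * N h"
proof (cases "y = z \<or> h = 0")
  case True
  then show ?thesis
    by (auto simp: crit is_norm_zero[OF N])
next
  case False
  define r where "r = N (y - z)"
  define k where "k = (r / N h) *\<^sub>R h"
  have r: "r > 0" and h: "N h > 0"
    using False is_norm_pos[OF N] by (auto simp: r_def)
  have Nk: "N k = r"
    using r h by (simp add: k_def is_norm_scale[OF N])
  have "grad F y \<bullet> k = bregman F (y + k) z - bregman F y z - bregman F (y + k) y"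
    by (simp add: bregman_def crit)
  then have "\<bar>grad F y \<bullet> k\<bar>
      \<le> \<bar>bregman F (y + k) z\<bar> + \<bar>bregman F y z\<bar> + \<bar>bregman F (y + k) y\<bar>"
    by linarith
  also have "\<dots> \<le> L / \<kappa> * N (y + k - z) powr \<kappa> + L / \<kappa> * N (y - z) powr \<kappa>
      + L / \<kappa> * N (y + k - y) powr \<kappa>"
    using smooth unfolding weakly_smooth_def by (intro add_mono) blast+
  also have "\<dots> = L / \<kappa> * (N (y + k - z) powr \<kappa> + 2 * r powr \<kappa>)"
    using Nk by (simp add: r_def algebra_simps)
  also have "\<dots> \<le> L / \<kappa> * (6 * r powr \<kappa>)"
  proof -
    have "N (y + k - z) \<le> 2 * r"
      using is_norm_triangle[OF N, of "y - z" k] Nk by (simp add: r_def algebra_simps)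
    then have "N (y + k - z) powr \<kappa> \<le> (2 * r) powr \<kappa>"
      using is_norm_nonneg[OF N] assms(4) by (intro powr_mono2) auto
    also have "\<dots> = 2 powr \<kappa> * r powr \<kappa>"
      using r by (simp add: powr_mult)
    also have "\<dots> \<le> 4 * r powr \<kappa>"
      using powr_mono[OF assms(5), of 2] by (intro mult_right_mono) auto
    finally show ?thesis
      using assms by (intro mult_left_mono) auto
  qed
  finally have "\<bar>grad F y \<bullet> k\<bar> \<le> 6 * (L / \<kappa>) * r powr \<kappa>"
    by (simp add: mult_ac)
  moreover have "grad F y \<bullet> k = r / N h * (grad F y \<bullet> h)"
    by (simp add: k_def)
  ultimately have "r / N h * \<bar>grad F y \<bullet> h\<bar> \<le> 6 * (L / \<kappa>) * r powr \<kappa>"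
    using r h by (simp add: abs_mult)
  also have "r powr \<kappa> = r * r powr (\<kappa> - 1)"
    using r by (simp add: powr_mult_base)
  finally have "r * \<bar>grad F y \<bullet> h\<bar> \<le> r * (6 * (L / \<kappa>) * r powr (\<kappa> - 1) * N h)"
    using h by (simp add: divide_le_eq mult_ac)
  then show ?thesis
    unfolding r_def[symmetric] using r by (rule mult_left_le_imp_le)
qed

text \<open>
  Only the comparison of the new point \<open>x\<close> with the centre \<open>y\<close> matters, so the lemma serves
  both for the Bregman regulariser and for the power of the norm: \<open>P\<close> stands for the value of
  the regulariser at \<open>x\<close>, its value at \<open>y\<close> being zero.
\<close>

lemma proximal_step_bound:
  assumes N: "is_norm N" and "0 < \<mu>" "0 < q" "0 \<le> a"
    and dual: "\<bar>g \<bullet> (x - y)\<bar> \<le> G * N (x - y)" and "0 \<le> G"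
    and descent: "a * (g \<bullet> x) + P \<le> a * (g \<bullet> y)"
    and regulariser: "\<mu> / q * N (x - y) powr q \<le> P"
  shows "N (x - y) powr (q - 1) \<le> q * a * G / \<mu>"
proof (cases "x = y")
  case True
  then show ?thesis
    using assms by (simp add: is_norm_zero)
next
  case False
  define n where "n = N (x - y)"
  have n: "n > 0"
    using False is_norm_pos[OF N] by (simp add: n_def)
  have "\<mu> / q * n powr q \<le> a * - (g \<bullet> (x - y))"
    using descent regulariser by (simp add: n_def inner_diff_right algebra_simps)
  also have "\<dots> \<le> a * (G * n)"
    using dual \<open>0 \<le> a\<close> by (intro mult_left_mono) (auto simp: n_def)
  finally have "\<mu> / q * (n * n powr (q - 1)) \<le> a * (G * n)"
    using n by (simp add: powr_mult_base)
  then have "n * (\<mu> / q * n powr (q - 1)) \<le> n * (a * G)"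
    by (simp add: mult_ac)
  then have "\<mu> / q * n powr (q - 1) \<le> a * G"
    using n by (rule mult_left_le_imp_le)
  then show ?thesis
    using \<open>0 < \<mu>\<close> \<open>0 < q\<close> by (simp add: n_def field_simps)
qed

lemma powr_le_imp_le_powr_inverse:
  fixes x y s :: real
  assumes "0 \<le> x" "0 < s" "x powr s \<le> y"
  shows "x \<le> y powr (1 / s)"
proof -
  have "x = (x powr s) powr (1 / s)"
    using assms by (simp add: powr_powr)
  also have "\<dots> \<le> y powr (1 / s)"
    using assms by (intro powr_mono2) auto
  finally show ?thesis .
qed

lemma powr_inverse_le_imp_le_powr:
  fixes x y s :: real
  assumes "0 \<le> x" "0 < s" "x powr (1 / s) \<le> y"
  shows "x \<le> y powr s"
  using powr_le_imp_le_powr_inverse[of x "1 / s" y] assms by simp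

text \<open>
  The exponent \<open>s = (n + 1) / (1 - p)\<close> balances the powers of \<open>t\<close>, as \<open>n + s p = s - 1\<close>, and
  \<open>M powr (1 / (1 - p))\<close> balances those of \<open>M\<close>. The lower bound on \<open>c\<close> reduces the increment to
  at most \<open>c M powr (1 / (1 - p)) * t powr (s - 1)\<close>, and \<open>t powr s + t powr (s - 1)\<close> is at most
  \<open>(t + 1) powr s\<close> because \<open>s \<ge> 1\<close>.
\<close>

lemma sublinear_recursion_bound:
  fixes S :: "nat \<Rightarrow> real" and p n M A c :: real
  assumes "0 \<le> p" "p < 1" "0 \<le> n" "0 < M" "0 \<le> A" "0 < c" and c: "A \<le> c powr (1 - p)"
    and nonneg: "\<And>t. 0 \<le> S t"
    and base: "S 1 \<le> c * M powr (1 / (1 - p))"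
    and step: "\<And>t. 1 \<le> t \<Longrightarrow> t \<le> T \<Longrightarrow> S (Suc t) \<le> S t + A * (M * real t powr n) * S t powr p"
  shows "1 \<le> t \<Longrightarrow> t \<le> Suc T \<Longrightarrow>
    S t \<le> c * (M powr (1 / (1 - p)) * real t powr ((n + 1) / (1 - p)))"
proof (induction t rule: nat_induct_at_least)
  case base
  then show ?case
    using assms(9) by simp
next
  case (Suc t)
  define U where "U = M powr (1 / (1 - p))"
  define s where "s = (n + 1) / (1 - p)"
  have U: "U > 0"
    using \<open>0 < M\<close> by (simp add: U_def)
  have t: "real t > 0"
    using Suc.hyps by simp
  have s: "s \<ge> 1" and exponent: "n + s * p = s - 1"
    using assms by (auto simp: s_def field_simps)
  have IH: "S t \<le> c * (U * real t powr s)"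
    using Suc by (simp add: U_def s_def)
  have MU: "M * U powr p = U"
  proof -
    have "M * U powr p = M powr (1 + 1 / (1 - p) * p)"
      using \<open>0 < M\<close> by (simp add: U_def powr_powr powr_add)
    also have "1 + 1 / (1 - p) * p = 1 / (1 - p)"
      using \<open>p < 1\<close> by (simp add: field_simps)
    finally show ?thesis
      by (simp add: U_def)
  qed
  have Ac: "A * c powr p \<le> c"
  proof -
    have "A * c powr p \<le> c powr (1 - p) * c powr p"
      using c by (intro mult_right_mono) auto
    also have "\<dots> = c"
      using \<open>0 < c\<close> by (simp flip: powr_add)
    finally show ?thesis .
  qed
  have "S (Suc t) \<le> S t + A * (M * real t powr n) * S t powr p"
    using step Suc by simp
  also have "\<dots> \<le> c * (U * real t powr s)
      + A * (M * real t powr n) * (c * (U * real t powr s)) powr p"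
    using IH nonneg assms by (intro add_mono mult_left_mono powr_mono2) auto
  also have "(c * (U * real t powr s)) powr p = c powr p * (U powr p * real t powr (s * p))"
    using \<open>0 < c\<close> U by (simp add: powr_mult powr_powr)
  also have "A * (M * real t powr n) * (c powr p * (U powr p * real t powr (s * p)))
      = A * c powr p * ((M * U powr p) * (real t powr n * real t powr (s * p)))"
    by (simp add: mult_ac)
  also have "\<dots> = A * c powr p * (U * real t powr (s - 1))"
    by (simp add: MU exponent flip: powr_add)
  also have "\<dots> \<le> c * (U * real t powr (s - 1))"
    using Ac U by (intro mult_right_mono) auto
  also have "c * (U * real t powr s) + c * (U * real t powr (s - 1))
      = c * (U * (real (Suc t) * real t powr (s - 1)))"
    using powr_mult_base[of "real t" "s - 1"] t by (simp add: algebra_simps)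
  also have "\<dots> \<le> c * (U * (real (Suc t) * real (Suc t) powr (s - 1)))"
    using \<open>0 < c\<close> U s by (intro mult_left_mono powr_mono2) auto
  also have "\<dots> = c * (U * real (Suc t) powr s)"
    using powr_mult_base[of "real (Suc t)" "s - 1"] by simp
  finally show ?case
    by (simp add: U_def s_def)
qed

lemma uniformly_convex_dist_le:
  assumes "is_norm N" "uniformly_convex N \<mu> q \<psi>" "0 < \<mu>" "0 < q" "bregman \<psi> x y \<le> B"
  shows "N (y - x) \<le> (q * B / \<mu>) powr (1 / q)"
proof (rule powr_le_imp_le_powr_inverse)
  have "\<mu> / q * N (x - y) powr q \<le> B"
    using assms unfolding uniformly_convex_def by (meson order_trans)
  then show "N (y - x) powr q \<le> q * B / \<mu>"
    using assms is_norm_minus[of N "x - y"] by (simp add: field_simps)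
qed (use assms is_norm_nonneg in auto)

text \<open>
  Both updates are proximal steps whose step size, multiplied by the gradient bound, is
  controlled by \<open>m\<close>. As \<open>m powr (q - 1)\<close> bounds \<open>q L \<eta>\<^sub>t / \<kappa>\<close> but only \<open>L \<alpha>\<^sub>t / \<kappa>\<close>, the first step has the constant
  \<open>6 / \<mu>\<close> and the second \<open>6 q / \<mu>\<close>; the larger one serves for both.
\<close>

lemma amd_iteration_growth:
  assumes N: "is_norm N" and "cont_diff F"
    and q: "q \<ge> 2" and \<kappa>: "1 < \<kappa>" "\<kappa> \<le> 2" and pos: "0 < L" "0 < \<mu>" "0 < \<alpha> t" "0 < \<eta> t"
    and min: "z \<in> argmin_set F" and smooth: "weakly_smooth N L \<kappa> F"
    and uconv: "uniformly_convex N \<mu> q \<psi>"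
    and sizes: "(q * L * \<eta> t / \<kappa>) powr (1 / (q - 1)) \<le> m" "(L * \<alpha> t / \<kappa>) powr (1 / (q - 1)) \<le> m"
    and run: "amd_run N F \<psi> \<mu> q C \<epsilon> \<alpha> \<eta> T lam xs xag xmd" and t: "1 \<le> t" "t \<le> T"
  defines "S \<equiv> \<lambda>t. max (N (xs t - z)) (N (xag t - z))"
  shows "N (xmd t - z) \<le> S t"
    and "S (Suc t) \<le> S t + (6 * q / \<mu>) powr (1 / (q - 1)) * m * S t powr ((\<kappa> - 1) / (q - 1))"
proof -
  define g where "g = grad F (xmd t)"
  define \<Delta> where "\<Delta> = (6 * q / \<mu>) powr (1 / (q - 1)) * m * S t powr ((\<kappa> - 1) / (q - 1))"
  define G where "G = 6 * (L / \<kappa>) * N (xmd t - z) powr (\<kappa> - 1)"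
  have lam: "lam t \<in> {0..1}" "xmd t = lam t *\<^sub>R xag t + (1 - lam t) *\<^sub>R xs t"
    and xs': "xs (Suc t) \<in> argmin_set (\<lambda>x. \<eta> t * (g \<bullet> x) + bregman \<psi> x (xs t))"
    and xag': "xag (Suc t) \<in> argmin_set (\<lambda>x. \<alpha> t * (g \<bullet> x) + \<mu> / q * N (x - xmd t) powr q)"
    using run t unfolding amd_run_def g_def by (meson atLeastAtMost_iff)+
  show md: "N (xmd t - z) \<le> S t"
    unfolding lam(2) using lam(1) by (intro is_norm_convex_comb_le[OF N]) (auto simp: S_def)
  have S: "0 \<le> S t"
    using is_norm_nonneg[OF N] by (auto simp: S_def le_max_iff_disj)
  have G: "0 \<le> G"
    using pos \<kappa> by (simp add: G_def)
  have dual: "\<bar>g \<bullet> h\<bar> \<le> G * N h" for h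
    using gradient_growth_from_weak_smoothness[OF N smooth grad_at_argmin[OF \<open>cont_diff F\<close> min]]
      \<kappa> pos by (simp add: g_def G_def)
  have m: "0 \<le> m"
    using sizes(1) powr_ge_zero order_trans by blast
  have sizes': "q * L * \<eta> t / \<kappa> \<le> m powr (q - 1)" "L * \<alpha> t / \<kappa> \<le> m powr (q - 1)"
    using q \<kappa> pos sizes by (auto intro!: powr_inverse_le_imp_le_powr)
  have move: "N v \<le> \<Delta>" if v: "N v powr (q - 1) \<le> 6 * q / \<mu> * m powr (q - 1) * N (xmd t - z) powr (\<kappa> - 1)"
    for v
  proof -
    have "6 * q / \<mu> * m powr (q - 1) * N (xmd t - z) powr (\<kappa> - 1)
        \<le> 6 * q / \<mu> * m powr (q - 1) * S t powr (\<kappa> - 1)"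
      using md \<kappa> q pos is_norm_nonneg[OF N] by (intro mult_left_mono powr_mono2) auto
    then have "N v \<le> (6 * q / \<mu> * m powr (q - 1) * S t powr (\<kappa> - 1)) powr (1 / (q - 1))"
      using v q is_norm_nonneg[OF N] by (intro powr_le_imp_le_powr_inverse) auto
    also have "\<dots> = (6 * q / \<mu>) powr (1 / (q - 1)) * (m powr (q - 1)) powr (1 / (q - 1))
        * (S t powr (\<kappa> - 1)) powr (1 / (q - 1))"
      using q pos by (subst powr_mult; simp add: powr_mult del: times_divide_eq_left)
    also have "\<dots> = \<Delta>"
      using q m by (simp add: \<Delta>_def powr_powr)
    finally show ?thesis .
  qed
  have "N (xs (Suc t) - xs t) powr (q - 1) \<le> q * \<eta> t * G / \<mu>"
  proof (rule proximal_step_bound[OF N])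
    show "\<eta> t * (g \<bullet> xs (Suc t)) + bregman \<psi> (xs (Suc t)) (xs t) \<le> \<eta> t * (g \<bullet> xs t)"
      using argmin_set_le[OF xs', of "xs t"] by (simp add: bregman_def)
    show "\<mu> / q * N (xs (Suc t) - xs t) powr q \<le> bregman \<psi> (xs (Suc t)) (xs t)"
      using uconv by (simp add: uniformly_convex_def)
  qed (use q pos G dual in auto)
  also have "\<dots> = 6 / \<mu> * (q * L * \<eta> t / \<kappa>) * N (xmd t - z) powr (\<kappa> - 1)"
    by (simp add: G_def mult_ac)
  also have "\<dots> \<le> 6 * q / \<mu> * m powr (q - 1) * N (xmd t - z) powr (\<kappa> - 1)"
    using sizes' q pos \<kappa> by (intro mult_right_mono mult_mono divide_right_mono) auto
  finally have xs_move: "N (xs (Suc t) - xs t) \<le> \<Delta>"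
    by (rule move)
  have "N (xag (Suc t) - xmd t) powr (q - 1) \<le> q * \<alpha> t * G / \<mu>"
  proof (rule proximal_step_bound[OF N])
    show "\<alpha> t * (g \<bullet> xag (Suc t)) + \<mu> / q * N (xag (Suc t) - xmd t) powr q \<le> \<alpha> t * (g \<bullet> xmd t)"
      using argmin_set_le[OF xag', of "xmd t"] by (simp add: is_norm_zero[OF N])
  qed (use q pos G dual in auto)
  also have "\<dots> = 6 * q / \<mu> * (L * \<alpha> t / \<kappa>) * N (xmd t - z) powr (\<kappa> - 1)"
    by (simp add: G_def mult_ac)
  also have "\<dots> \<le> 6 * q / \<mu> * m powr (q - 1) * N (xmd t - z) powr (\<kappa> - 1)"
    using sizes' q pos by (intro mult_right_mono mult_left_mono) auto
  finally have xag_move: "N (xag (Suc t) - xmd t) \<le> \<Delta>"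
    by (rule move)
  have "N (xs (Suc t) - z) \<le> S t + \<Delta>"
    using is_norm_triangle[OF N, of "xs (Suc t) - xs t" "xs t - z"] xs_move
    by (simp add: S_def)
  moreover have "N (xag (Suc t) - z) \<le> S t + \<Delta>"
    using is_norm_triangle[OF N, of "xag (Suc t) - xmd t" "xmd t - z"] xag_move md
    by simp
  ultimately show "S (Suc t) \<le> S t + (6 * q / \<mu>) powr (1 / (q - 1)) * m * S t powr ((\<kappa> - 1) / (q - 1))"
    by (simp add: S_def \<Delta>_def)
qed

theorem theorem4p2:
  fixes N F \<psi> :: "real ^ 'd \<Rightarrow> real"
    and q \<kappa> \<tau> L \<mu> B :: real
    and xstar :: "real ^ 'd"
  assumes "is_norm N"
    and "cont_diff F" and "cont_diff \<psi>"
    and "q \<ge> 2" and "1 < \<kappa>" and "\<kappa> \<le> 2" and "\<kappa> < q"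
    and "\<tau> > 0" and "L > 0" and "\<mu> > 0"
    and "star_convex_at \<tau> F xstar"
    and "weakly_smooth N L \<kappa> F"
    and "uniformly_convex N \<mu> q \<psi>"
  shows "\<exists>c::real. \<forall>(K::real) (n1::real) (n2::real)
           (C :: nat \<Rightarrow> real) (\<epsilon> :: nat \<Rightarrow> real) (\<alpha> :: nat \<Rightarrow> real) (\<eta> :: nat \<Rightarrow> real) (T::nat)
           (lam :: nat \<Rightarrow> real) (xs :: nat \<Rightarrow> real ^ 'd) (xag :: nat \<Rightarrow> real ^ 'd) (xmd :: nat \<Rightarrow> real ^ 'd).
         K > 0 \<and> n1 \<ge> 0 \<and> n2 \<ge> 0 \<and> K powr n1 > B \<and>
         (\<forall>t\<ge>1. \<alpha> t > 0 \<and> \<eta> t > 0) \<and>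
         (\<forall>t\<ge>1. max ((q * L * \<eta> t / \<kappa>) powr (1 / (q - 1))) ((L * \<alpha> t / \<kappa>) powr (1 / (q - 1)))
                 \<le> K powr n1 * real t powr n2) \<and>
         amd_run N F \<psi> \<mu> q C \<epsilon> \<alpha> \<eta> T lam xs xag xmd \<and>
         bregman \<psi> xstar (xs 1) \<le> B
         \<longrightarrow> (\<forall>t\<in>{1..T}.
                Max {N (xs t - xstar), N (xag t - xstar), N (xmd t - xstar)}
                \<le> c * (K powr (n1 * (q - 1) / (q - \<kappa>)) * real t powr ((q - 1) * (n2 + 1) / (q - \<kappa>))))"
proof -
  define p where "p = (\<kappa> - 1) / (q - 1)"
  define A where "A = (6 * q / \<mu>) powr (1 / (q - 1))"
  \<comment> \<open>The first argument makes the recursion close; the second makes the claim hold at \<open>t = 1\<close>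
    for every \<open>K powr n1 > B\<close>. If \<open>B = 0\<close>, the second has the value zero and
    \<open>x\<^sub>1 = x\<^sub>\<star>\<close>.\<close>
  define c where "c = max (A powr (1 / (1 - p))) ((q * B / \<mu>) powr (1 / q) / B powr (1 / (1 - p)))"
  have p: "0 \<le> p" "p < 1" and p': "1 / (1 - p) = (q - 1) / (q - \<kappa>)"
    using assms by (auto simp: p_def field_simps)
  have A: "0 < A"
    using assms by (simp add: A_def)
  have c: "0 < c"
    using A by (simp add: c_def less_max_iff_disj)
  have Ac: "A \<le> c powr (1 - p)"
    using A p by (intro powr_inverse_le_imp_le_powr) (auto simp: c_def)
  have min: "xstar \<in> argmin_set F"
    using \<open>star_convex_at \<tau> F xstar\<close> by (simp add: star_convex_at_def)
  show ?thesis
  proof (intro exI[of _ c] allI impI ballI, elim conjE)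
    fix K n1 n2 :: real and C \<epsilon> \<alpha> \<eta> :: "nat \<Rightarrow> real" and T :: nat and lam :: "nat \<Rightarrow> real"
      and xs xag xmd :: "nat \<Rightarrow> real ^ 'd" and t :: nat
    assume K: "K > 0" "n2 \<ge> 0" "K powr n1 > B"
      and pos: "\<forall>t\<ge>1. \<alpha> t > 0 \<and> \<eta> t > 0"
      and sizes: "\<forall>t\<ge>1. max ((q * L * \<eta> t / \<kappa>) powr (1 / (q - 1))) ((L * \<alpha> t / \<kappa>) powr (1 / (q - 1)))
                 \<le> K powr n1 * real t powr n2"
      and run: "amd_run N F \<psi> \<mu> q C \<epsilon> \<alpha> \<eta> T lam xs xag xmd"
      and init: "bregman \<psi> xstar (xs 1) \<le> B"
      and t: "t \<in> {1..T}"
    define M where "M = K powr n1"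
    define S where "S = (\<lambda>t. max (N (xs t - xstar)) (N (xag t - xstar)))"
    have growth: "N (xmd i - xstar) \<le> S i"
      "S (Suc i) \<le> S i + A * (M * real i powr n2) * S i powr p" if "1 \<le> i" "i \<le> T" for i
      using amd_iteration_growth[OF \<open>is_norm N\<close> \<open>cont_diff F\<close> \<open>q \<ge> 2\<close> \<open>1 < \<kappa>\<close> \<open>\<kappa> \<le> 2\<close>
          \<open>L > 0\<close> \<open>\<mu> > 0\<close> _ _ min \<open>weakly_smooth N L \<kappa> F\<close> \<open>uniformly_convex N \<mu> q \<psi>\<close> _ _ run that,
          of "M * real i powr n2"] pos sizes that
      by (auto simp: S_def A_def M_def p_def)
    have S1: "S 1 \<le> c * M powr (1 / (1 - p))"
    proof -
      have dist: "N (xs 1 - xstar) \<le> (q * B / \<mu>) powr (1 / q)"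
        using assms init by (intro uniformly_convex_dist_le) auto
      have "0 \<le> \<mu> / q * N (xstar - xs 1) powr q"
        using assms by simp
      then have "B \<ge> 0"
        using \<open>uniformly_convex N \<mu> q \<psi>\<close> init unfolding uniformly_convex_def
        by (meson order_trans)
      have "(q * B / \<mu>) powr (1 / q)
          = (q * B / \<mu>) powr (1 / q) / B powr (1 / (1 - p)) * B powr (1 / (1 - p))"
        by simp
      also have "\<dots> \<le> c * M powr (1 / (1 - p))"
        using K p c \<open>B \<ge> 0\<close> by (intro mult_mono powr_mono2) (auto simp: c_def M_def)
      finally show ?thesis
        using dist run by (simp add: S_def amd_run_def)
    qed
    have "S t \<le> c * (M powr (1 / (1 - p)) * real t powr ((n2 + 1) / (1 - p)))"
    proof (rule sublinear_recursion_bound[where A = A and T = T and S = S])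
      show "0 \<le> S i" for i
        using is_norm_nonneg[OF \<open>is_norm N\<close>] by (simp add: S_def le_max_iff_disj)
    qed (use p K A c Ac S1 growth t in \<open>auto simp: M_def\<close>)
    moreover have "M powr (1 / (1 - p)) = K powr (n1 * (q - 1) / (q - \<kappa>))"
      by (simp add: M_def powr_powr p')
    moreover have "(n2 + 1) / (1 - p) = (q - 1) * (n2 + 1) / (q - \<kappa>)"
      using arg_cong[OF p', of "\<lambda>u. (n2 + 1) * u"] by (simp add: mult_ac)
    ultimately show "Max {N (xs t - xstar), N (xag t - xstar), N (xmd t - xstar)}
        \<le> c * (K powr (n1 * (q - 1) / (q - \<kappa>)) * real t powr ((q - 1) * (n2 + 1) / (q - \<kappa>)))"
      using growth(1)[of t] t by (auto simp: S_def)
  qed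
qed

end
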